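(* Let $G(z,\xi)=f(z)+Q(z,\xi)$ with $\xi=(h,T)$ and $Q(z,\xi)=\min\{q^\top y: Wy=h-Tz,\ y\ge0\}$. Given observations $(X_1,\xi_1),\dots,(X_N,\xi_N)$, let $\theta_N^*$ be an optimal solution of the bilevel problem $$\min_{\theta\in\Theta}\ \frac1N\sum_{n=1}^N G\bigl(z_D^*(\hat\xi_n),\xi_n\bigr)\quad\text{s.t.}\quad \hat\xi_n=\Psi(\theta,X_n),\quad z_D^*(\hat\xi_n)=\operatorname*{argmin}_{z\in Z}G(z,\hat\xi_n),\quad n=1,\dots,N.$$ Suppose that: (a) $Z$ is non-empty and $\mathrm{ri}(\mathrm{Dom}\, f)$ is non-empty; the set $U=\{u\in\mathbb{R}^m: W^\top u\le q\}$ is non-empty and bounded; and the one-scenario problem $\min_{z\in Z} f(z)+Q(z,\xi)$ has a unique optimal solution for each value of $\xi$; (b) the data process $(X_1,\xi_1),\dots,(X_N,\xi_N)$ is independent and identically distributed; (c) the random variable $\xi$ is integrable; (d) the feasibility set $Z$ is bounded; (e) the set $\Theta$ is finite and non-empty. Then the event $\theta_N^*\in S^*$ happens with probability 1 for $N$ large enough, where $$S^*=\operatorname*{argmin}_{\theta\in\Theta}\ \mathcal{P}(\widetilde\pi_D^\theta).$$ If, in addition, the support $\Xi$ of $\xi$ is bounded, then the convergence occurs exponentially fast, in the sense that there exist positive constants $K$ and $\beta$ such that $$P(\theta_N^*\notin S^* )\le K e^{-N\beta}.$$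
   Context: $Z\subseteq\mathbb{R}^n$ is a convex set; $f:\mathbb{R}^n\to\mathbb{R}$ is convex with $Z\subseteq\mathrm{Dom}\, f$. $\xi=(h,T)$ is the random element, with $h$ a random vector in $\mathbb{R}^m$ and $T$ a random $m\times n$ matrix; $W$ and $q$ are deterministic. $X$ is a random vector (contextual information) with support $\mathcal{X}\subseteq\mathbb{R}^s$, jointly distributed with $\xi$; the pairs $(X_n,\xi_n)$ are observations of $(X,\xi)$. $\Psi(\theta,x)$ is a pointwise forecast function of $\xi$ as a function of $x$, parameterized by $\theta\in\Theta$. The function $z_D^*$ is defined by $z_D^*(\xi):=\operatorname*{argmin}_{z\in Z} f(z)+Q(z,\xi)$ (single-valued by (a)), the policy $\widetilde\pi_D^\theta$ is defined by $\widetilde\pi_D^\theta(x):=z_D^*(\Psi(\theta,x))$, and for a policy $\pi:\mathcal{X}\to Z$, $\mathcal{P}(\pi):=\mathbb{E}_{X,\xi}[G(\pi(X),\xi)]$. *)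

theory Defs
  imports "HOL-Probability.Probability"
begin

type_synonym ('m, 'n) scenario = "(real ^ 'm) \<times> (real ^ 'n ^ 'm)"

definition recourse ::
  "real ^ 'k ^ 'm \<Rightarrow> real ^ 'k \<Rightarrow> real ^ 'n \<Rightarrow> ('m, 'n) scenario \<Rightarrow> real"
  where "recourse W q z \<xi> =
    (LEAST v. \<exists>y. W *v y = fst \<xi> - snd \<xi> *v z \<and> 0 \<le> y \<and> v = q \<bullet> y)"

definition total_cost ::
  "(real ^ 'n \<Rightarrow> real) \<Rightarrow> real ^ 'k ^ 'm \<Rightarrow> real ^ 'k \<Rightarrow> real ^ 'n \<Rightarrow> ('m, 'n) scenario \<Rightarrow> real"
  where "total_cost f W q z \<xi> = f z + recourse W q z \<xi>"

text \<open>The choice made by \<^const>\<open>arg_min_on\<close> is immaterial wherever the minimiser is unique.\<close>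

definition scenario_solution ::
  "(real ^ 'n) set \<Rightarrow> (real ^ 'n \<Rightarrow> real) \<Rightarrow> real ^ 'k ^ 'm \<Rightarrow> real ^ 'k \<Rightarrow>
    ('m, 'n) scenario \<Rightarrow> real ^ 'n"
  where "scenario_solution Z f W q \<xi> = arg_min_on (\<lambda>z. total_cost f W q z \<xi>) Z"

definition forecast_policy ::
  "(real ^ 'n) set \<Rightarrow> (real ^ 'n \<Rightarrow> real) \<Rightarrow> real ^ 'k ^ 'm \<Rightarrow> real ^ 'k \<Rightarrow>
    ('p \<Rightarrow> real ^ 's \<Rightarrow> ('m, 'n) scenario) \<Rightarrow> 'p \<Rightarrow> real ^ 's \<Rightarrow> real ^ 'n"
  where "forecast_policy Z f W q \<Psi> \<theta> x = scenario_solution Z f W q (\<Psi> \<theta> x)"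

text \<open>
  Expectation with values in the extended reals. The Bochner integral of a non-integrable function
  is 0, which would be the wrong value for a policy of infinite expected cost; such policies can
  occur when \<open>f\<close> is unbounded above on \<open>Z\<close>.
\<close>

definition ext_expectation :: "'w measure \<Rightarrow> ('w \<Rightarrow> real) \<Rightarrow> ereal"
  where "ext_expectation M Y =
    enn2ereal (\<integral>\<^sup>+\<omega>. ennreal (Y \<omega>) \<partial>M) - enn2ereal (\<integral>\<^sup>+\<omega>. ennreal (- Y \<omega>) \<partial>M)"

lemma ext_expectation_integrable:
  assumes "integrable M Y"
  shows "ext_expectation M Y = ereal (\<integral>\<omega>. Y \<omega> \<partial>M)"
proof -
  obtain r p where "0 \<le> r" "0 \<le> p" "(\<integral>\<^sup>+\<omega>. ennreal (Y \<omega>) \<partial>M) = ennreal r"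
    "(\<integral>\<^sup>+\<omega>. ennreal (- Y \<omega>) \<partial>M) = ennreal p" "(\<integral>\<omega>. Y \<omega> \<partial>M) = r - p"
    using integrableE[OF assms] by metis
  then show ?thesis
    by (simp add: ext_expectation_def enn2ereal_ennreal)
qed

definition policy_cost ::
  "'w measure \<Rightarrow> ('w \<Rightarrow> real ^ 's) \<Rightarrow> ('w \<Rightarrow> ('m, 'n) scenario) \<Rightarrow>
    (real ^ 'n \<Rightarrow> real) \<Rightarrow> real ^ 'k ^ 'm \<Rightarrow> real ^ 'k \<Rightarrow> (real ^ 's \<Rightarrow> real ^ 'n) \<Rightarrow> ereal"
  where "policy_cost M X \<xi> f W q \<pi> =
    ext_expectation M (\<lambda>\<omega>. total_cost f W q (\<pi> (X \<omega>)) (\<xi> \<omega>))"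

definition optimal_parameters ::
  "'w measure \<Rightarrow> ('w \<Rightarrow> real ^ 's) \<Rightarrow> ('w \<Rightarrow> ('m, 'n) scenario) \<Rightarrow>
    (real ^ 'n) set \<Rightarrow> (real ^ 'n \<Rightarrow> real) \<Rightarrow> real ^ 'k ^ 'm \<Rightarrow> real ^ 'k \<Rightarrow>
    ('p \<Rightarrow> real ^ 's \<Rightarrow> ('m, 'n) scenario) \<Rightarrow> 'p set \<Rightarrow> 'p set"
  where "optimal_parameters M X \<xi> Z f W q \<Psi> \<Theta> =
    {\<theta>. is_arg_min (\<lambda>\<theta>. policy_cost M X \<xi> f W q (forecast_policy Z f W q \<Psi> \<theta>)) (\<lambda>\<theta>. \<theta> \<in> \<Theta>) \<theta>}"

definition empirical_cost ::
  "(real ^ 'n) set \<Rightarrow> (real ^ 'n \<Rightarrow> real) \<Rightarrow> real ^ 'k ^ 'm \<Rightarrow> real ^ 'k \<Rightarrow>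
    ('p \<Rightarrow> real ^ 's \<Rightarrow> ('m, 'n) scenario) \<Rightarrow>
    (nat \<Rightarrow> real ^ 's) \<Rightarrow> (nat \<Rightarrow> ('m, 'n) scenario) \<Rightarrow> nat \<Rightarrow> 'p \<Rightarrow> real"
  where "empirical_cost Z f W q \<Psi> x s N \<theta> =
    (1 / real N) * (\<Sum>n=1..N. total_cost f W q (scenario_solution Z f W q (\<Psi> \<theta> (x n))) (s n))"

definition rv_support :: "'w measure \<Rightarrow> ('w \<Rightarrow> 'a::topological_space) \<Rightarrow> 'a set"
  where "rv_support M Y = {y. \<forall>V. open V \<and> y \<in> V \<longrightarrow> measure (distr M borel Y) V > 0}"

end

theory Submission
  imports Defs
begin

text \<open>
  Since \<open>\<Theta>\<close> is finite, it suffices to compare parameters in pairs. If \<open>\<theta> \<in> \<Theta>\<close> is not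
  optimal, some \<open>\<theta>'\<close> has a strictly smaller expected cost. If the empirical cost of \<open>\<theta>'\<close> is also
  strictly smaller than that of \<open>\<theta>\<close>, then \<open>\<theta>\<close> cannot minimise the empirical cost. The theorem thus
  reduces to the signs of sums of independent copies of the cost difference, a random variable of
  negative (possibly infinite) mean: such sums are almost surely eventually negative, and if the
  difference is bounded, Hoeffding's inequality makes a nonnegative sum exponentially unlikely.

  Two points need work. The first is integrability. The recourse problem is a linear program
  whose dual feasible set \<open>U\<close> is nonempty and bounded; therefore it is solvable for every right-hand
  side, and its value grows at most linearly in the scenario, uniformly over the bounded set \<open>Z\<close>
  (\<open>recourse_linear_growth\<close>). On \<open>Z\<close>, \<open>f\<close> is bounded below, because the zero scenario makes the
  recourse cost vanish and its problem has a minimiser. Every policy cost is therefore bounded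
  below by an integrable variable, but it may have infinite mean. The better of two
  costs has finite mean, and cutting off the worse one at a high level makes its mean finite too
  without changing the order
  (\<open>integrable_truncation_separates\<close>).

  The second is the strong law of large numbers under mere integrability, of which only one side is
  needed: partial sums of i.i.d. variables with negative mean are almost surely bounded above
  (\<open>AE_running_max_bounded\<close>). Let \<open>F\<^sub>n\<close> be the maximum of the first \<open>n\<close> partial sums of
  \<open>y\<^sub>0, y\<^sub>1, \<dots>\<close> and of \<open>0\<close>, let \<open>F\<^sub>n'\<close> be the same functional of the shifted sequence
  \<open>y\<^sub>1, y\<^sub>2, \<dots>\<close>, and let \<open>A\<close> be the shift-invariant event that \<open>F\<^sub>n\<close> is unbounded. Since
  \<open>F\<^bsub>n+1\<^esub> = max 0 (y\<^sub>0 + F\<^sub>n')\<close>, the difference \<open>F\<^bsub>n+1\<^esub> - F\<^sub>n'\<close> equals \<open>max (- F\<^sub>n') y\<^sub>0\<close>. By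
  stationarity and monotonicity in \<open>n\<close>, its expectation over \<open>A\<close> is nonnegative. On \<open>A\<close> it tends
  to \<open>y\<^sub>0\<close>, which is independent of the shifted sequence and hence of \<open>A\<close>, so dominated
  convergence gives \<open>0 \<le> P(A) E[y\<^sub>0]\<close>, which forces \<open>P(A) = 0\<close>.
\<close>

section \<open>Linear growth of the recourse cost\<close>

lemma nonneg_orthant_eq_cone_hull:
  "{y :: real ^ 'k. 0 \<le> y} = convex_cone hull (range (\<lambda>i. axis i 1))"
proof
  show "{y :: real ^ 'k. 0 \<le> y} \<subseteq> convex_cone hull (range (\<lambda>i. axis i 1))"
  proof
    fix y :: "real ^ 'k" assume "y \<in> {y. 0 \<le> y}"
    then have nonneg: "0 \<le> y $ i" for i
      by (simp add: less_eq_vec_def)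
    have "(\<Sum>i\<in>A. (y $ i) *\<^sub>R axis i (1::real)) \<in> convex_cone hull (range (\<lambda>i. axis i 1))" for A
    proof (induction A rule: infinite_finite_induct)
      case (insert i A)
      then show ?case
        by (simp add: convex_cone_hull_add convex_cone_hull_mul hull_inc nonneg)
    qed (simp_all add: convex_cone_hull_contains_0)
    from this[of UNIV] show "y \<in> convex_cone hull (range (\<lambda>i. axis i 1))"
      using basis_expansion[of y] by (simp add: scalar_mult_eq_scaleR)
  qed
  show "convex_cone hull (range (\<lambda>i. axis i 1)) \<subseteq> {y :: real ^ 'k. 0 \<le> y}"
    by (rule hull_minimal) (auto simp: convex_cone_iff less_eq_vec_def axis_def)
qed

text \<open>
  The image is generated by finitely many vectors, the images of the coordinate vectors, so it is
  polyhedral. Closedness is what turns infima of linear programs into minima and allows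
  separation from an infeasible right-hand side.
\<close>

lemma linear_image_nonneg_orthant:
  fixes g :: "real ^ 'k \<Rightarrow> 'a::euclidean_space"
  assumes "linear g"
  shows "closed (g ` {y. 0 \<le> y})" and "convex_cone (g ` {y. 0 \<le> y})"
proof -
  have eq: "g ` {y. 0 \<le> y} = convex_cone hull (g ` range (\<lambda>i. axis i 1))"
    unfolding nonneg_orthant_eq_cone_hull using convex_cone_hull_linear_image[OF assms] by metis
  show "closed (g ` {y. 0 \<le> y})"
    unfolding eq by (intro polyhedron_imp_closed polyhedron_convex_cone_hull) simp
  show "convex_cone (g ` {y. 0 \<le> y})"
    unfolding eq by (rule convex_cone_convex_cone_hull)
qed

lemma inner_transpose:
  fixes W :: "real ^ 'k ^ 'm"
  shows "(transpose W *v u) \<bullet> y = u \<bullet> (W *v y)"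
  by (metis transpose_matrix_vector dot_lmul_matrix)

lemma weak_duality:
  fixes W :: "real ^ 'k ^ 'm"
  assumes "transpose W *v u \<le> q" and "0 \<le> y"
  shows "u \<bullet> (W *v y) \<le> q \<bullet> y"
proof -
  have "u \<bullet> (W *v y) = (transpose W *v u) \<bullet> y"
    by (rule inner_transpose[symmetric])
  also have "\<dots> \<le> q \<bullet> y"
    using assms unfolding inner_vec_def
    by (intro sum_mono) (auto simp: less_eq_vec_def intro: mult_right_mono)
  finally show ?thesis .
qed

text \<open>
  If \<open>b\<close> were not in the closed cone spanned by the columns of \<open>W\<close>, a hyperplane with normal \<open>a\<close>
  would separate the two, and \<open>- a\<close> would be a direction in which the dual feasible set extends to
  infinity.
\<close>

lemma complete_recourse:
  fixes W :: "real ^ 'k ^ 'm"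
  assumes "{u. transpose W *v u \<le> q} \<noteq> {}" and "bounded {u. transpose W *v u \<le> q}"
  shows "\<exists>y. W *v y = b \<and> 0 \<le> y"
proof (rule ccontr)
  assume infeasible: "\<nexists>y. W *v y = b \<and> 0 \<le> y"
  define C where "C = (*v) W ` {y. 0 \<le> y}"
  have "linear ((*v) W)" by simp
  note closed = linear_image_nonneg_orthant(1)[OF this, folded C_def]
    and cone = linear_image_nonneg_orthant(2)[OF this, folded C_def]
  have "b \<notin> C" using infeasible by (auto simp: C_def)
  then obtain a c where a: "a \<bullet> b < c" "\<And>x. x \<in> C \<Longrightarrow> c < a \<bullet> x"
    using separating_hyperplane_closed_point[of C b] closed cone
    by (auto simp: convex_cone_def)
  have "c < 0" using a(2)[of 0] convex_cone_contains_0[OF cone] by simp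
  \<comment> \<open>A negative value could be scaled inside the cone down to the separating level \<open>c\<close>.\<close>
  have nonneg: "0 \<le> a \<bullet> x" if "x \<in> C" for x
  proof (rule ccontr)
    assume neg: "\<not> 0 \<le> a \<bullet> x"
    have "(c / (a \<bullet> x)) *\<^sub>R x \<in> C"
      using cone that \<open>c < 0\<close> neg by (auto simp: convex_cone_def divide_nonpos_neg intro: conic_mul)
    from a(2)[OF this] show False using neg by simp
  qed
  have dir: "transpose W *v a \<ge> 0"
  proof -
    have "0 \<le> (transpose W *v a) $ i" for i
    proof -
      have "W *v axis i 1 \<in> C" by (auto simp: C_def less_eq_vec_def axis_def)
      from nonneg[OF this] show ?thesis
        using inner_transpose[of W a "axis i 1"] by (simp add: inner_axis)
    qed
    then show ?thesis by (simp add: less_eq_vec_def)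
  qed
  have "a \<noteq> 0" using a(1) \<open>c < 0\<close> by auto
  obtain u where u: "transpose W *v u \<le> q" using assms(1) by auto
  obtain B where B: "\<And>u. transpose W *v u \<le> q \<Longrightarrow> norm u \<le> B"
    using assms(2) by (auto simp: bounded_iff)
  \<comment> \<open>A step length that takes \<open>u - t *\<^sub>R a\<close> out of the ball of radius \<open>B\<close>.\<close>
  define t where "t = (B + norm u + 1) / norm a"
  have "0 \<le> B" using B[OF u] norm_ge_zero order_trans by blast
  then have t: "0 \<le> t" "t * norm a = B + norm u + 1"
    using \<open>a \<noteq> 0\<close> by (auto simp: t_def)
  have "transpose W *v (u - t *\<^sub>R a) \<le> q"
  proof -
    have "transpose W *v (u - t *\<^sub>R a) = transpose W *v u - t *\<^sub>R (transpose W *v a)"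
      by (simp add: matrix_vector_mult_diff_distrib scaleR_matrix_vector_assoc matrix_vector_mult_scaleR)
    then show ?thesis
      using u dir t(1) by (simp add: less_eq_vec_def) (smt (verit) mult_nonneg_nonneg)
  qed
  from B[OF this] have "norm (u - t *\<^sub>R a) \<le> B" .
  moreover have "norm (t *\<^sub>R a) \<le> norm u + norm (u - t *\<^sub>R a)"
    by (metis norm_triangle_sub norm_minus_commute add.commute)
  ultimately show False using t by simp
qed

text \<open>
  The attainable pairs of right-hand side and cost form a closed cone, hence the attainable costs
  at a fixed right-hand side form a closed set. It is bounded below by weak duality, so the
  \<open>LEAST\<close> in \<^const>\<open>recourse\<close> is a genuine minimum.
\<close>

lemma recourse_attained:
  fixes W :: "real ^ 'k ^ 'm"
  assumes "{u. transpose W *v u \<le> q} \<noteq> {}" and "bounded {u. transpose W *v u \<le> q}"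
  obtains y where "W *v y = fst \<zeta> - snd \<zeta> *v z" and "0 \<le> y" and "recourse W q z \<zeta> = q \<bullet> y"
    and "\<And>y'. W *v y' = fst \<zeta> - snd \<zeta> *v z \<Longrightarrow> 0 \<le> y' \<Longrightarrow> q \<bullet> y \<le> q \<bullet> y'"
proof -
  define b where "b = fst \<zeta> - snd \<zeta> *v z"
  define V where "V = {v. \<exists>y. W *v y = b \<and> 0 \<le> y \<and> v = q \<bullet> y}"
  define L where "L = (\<lambda>y. (W *v y, q \<bullet> y)) ` {y. 0 \<le> y}"
  have "linear (\<lambda>y. (W *v y, q \<bullet> y))"
    by (intro linearI) (simp_all add: matrix_vector_right_distrib matrix_vector_mult_scaleR inner_add_right)
  then have "closed L"
    unfolding L_def by (rule linear_image_nonneg_orthant)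
  moreover have "V = Pair b -` L"
    by (auto simp: V_def L_def)
  ultimately have "closed V"
    by (simp add: closed_vimage continuous_on_Pair)
  moreover have "V \<noteq> {}"
    using complete_recourse[OF assms, of b] by (auto simp: V_def)
  moreover obtain u where "transpose W *v u \<le> q" using assms(1) by auto
  then have bdd: "bdd_below V"
    using weak_duality by (intro bdd_belowI[of _ "u \<bullet> b"]) (auto simp: V_def)
  ultimately have "Inf V \<in> V"
    by (simp add: closed_contains_Inf)
  then obtain y where y: "W *v y = b" "0 \<le> y" "Inf V = q \<bullet> y"
    by (auto simp: V_def)
  have min: "q \<bullet> y \<le> q \<bullet> y'" if "W *v y' = b" "0 \<le> y'" for y'
    using cInf_lower[OF _ bdd, of "q \<bullet> y'"] that y(3) by (auto simp: V_def)
  have "recourse W q z \<zeta> = q \<bullet> y"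
    unfolding recourse_def using y min by (intro Least_equality) (auto simp: b_def)
  then show thesis using that y min by (simp add: b_def)
qed

text \<open>
  Below, a fixed dual feasible \<open>u\<close> gives the bound. Above, it suffices to exhibit one cheap feasible
  point: solutions for the right-hand sides \<open>\<plusminus>e\<^sub>i\<close>, combined with the weights \<open>\<bar>b\<^sub>i\<bar>\<close>, solve the
  problem for \<open>b\<close> at a cost linear in \<open>b\<close>.
\<close>

lemma recourse_bound:
  fixes W :: "real ^ 'k ^ 'm"
  assumes U: "{u. transpose W *v u \<le> q} \<noteq> {}" "bounded {u. transpose W *v u \<le> q}"
  obtains C where "0 \<le> C"
    and "\<And>z :: real ^ 'n. \<And>\<zeta>. \<bar>recourse W q z \<zeta>\<bar> \<le> C * norm (fst \<zeta> - snd \<zeta> *v z)"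
proof -
  obtain Y where Y: "\<And>e. W *v Y e = e" "\<And>e. 0 \<le> Y e"
    using complete_recourse[OF U] by metis
  obtain u where u: "transpose W *v u \<le> q" using U(1) by auto
  define C where "C = norm u + (\<Sum>i\<in>UNIV. norm q * (norm (Y (axis i 1)) + norm (Y (- axis i 1))))"
  have "\<bar>recourse W q z \<zeta>\<bar> \<le> C * norm (fst \<zeta> - snd \<zeta> *v z)" for z :: "real ^ 'n" and \<zeta>
  proof -
    define b where "b = fst \<zeta> - snd \<zeta> *v z"
    obtain y where y: "W *v y = b" "0 \<le> y" "recourse W q z \<zeta> = q \<bullet> y"
      and min: "\<And>y'. W *v y' = b \<Longrightarrow> 0 \<le> y' \<Longrightarrow> q \<bullet> y \<le> q \<bullet> y'"
      using recourse_attained[OF U, of \<zeta> z] unfolding b_def by metis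
    have lower: "- (norm u * norm b) \<le> q \<bullet> y"
      using weak_duality[OF u y(2)] Cauchy_Schwarz_ineq2[of u b] y(1) by auto
    define y' where "y' = (\<Sum>i\<in>UNIV. \<bar>b $ i\<bar> *\<^sub>R Y (sgn (b $ i) *\<^sub>R axis i 1))"
    have "W *v y' = (\<Sum>i\<in>UNIV. (b $ i) *\<^sub>R axis i 1)"
      unfolding y'_def by (simp add: linear_sum[of "(*v) W"] matrix_vector_mult_scaleR Y(1) abs_mult_sgn)
    then have "W *v y' = b"
      using basis_expansion[of b] by (simp add: scalar_mult_eq_scaleR)
    moreover have "0 \<le> y'"
      using Y(2) unfolding y'_def less_eq_vec_def by (auto intro!: sum_nonneg)
    ultimately have "q \<bullet> y \<le> q \<bullet> y'" by (rule min)
    also have "\<dots> = (\<Sum>i\<in>UNIV. \<bar>b $ i\<bar> * (q \<bullet> Y (sgn (b $ i) *\<^sub>R axis i 1)))"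
      by (simp add: y'_def inner_sum_right)
    also have "\<dots> \<le> (\<Sum>i\<in>UNIV. norm b * (norm q * (norm (Y (axis i 1)) + norm (Y (- axis i 1)))))"
    proof (rule sum_mono)
      fix i
      have "b $ i = 0 \<or> sgn (b $ i) = 1 \<or> sgn (b $ i) = - 1" by (auto simp: sgn_if)
      then consider "b $ i = 0" | "sgn (b $ i) = 1" | "sgn (b $ i) = - 1" by blast
      then have "\<bar>b $ i\<bar> * (q \<bullet> Y (sgn (b $ i) *\<^sub>R axis i 1))
          \<le> \<bar>b $ i\<bar> * (norm q * (norm (Y (axis i 1)) + norm (Y (- axis i 1))))"
      proof cases
        case 2
        have "q \<bullet> Y (axis i 1) \<le> norm q * norm (Y (axis i 1))" by (rule norm_cauchy_schwarz)
        then show ?thesis unfolding 2 by (intro mult_left_mono) (auto simp: distrib_left add_increasing2)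
      next
        case 3
        have "q \<bullet> Y (- axis i 1) \<le> norm q * norm (Y (- axis i 1))" by (rule norm_cauchy_schwarz)
        then show ?thesis unfolding 3 by (intro mult_left_mono) (auto simp: distrib_left add_increasing)
      qed simp
      also have "\<dots> \<le> norm b * (norm q * (norm (Y (axis i 1)) + norm (Y (- axis i 1))))"
        by (intro mult_right_mono component_le_norm_cart) auto
      finally show "\<bar>b $ i\<bar> * (q \<bullet> Y (sgn (b $ i) *\<^sub>R axis i 1)) \<le> \<dots>" .
    qed
    also have "\<dots> = (C - norm u) * norm b"
      by (simp add: C_def sum_distrib_left mult.commute)
    finally have upper: "q \<bullet> y \<le> (C - norm u) * norm b" .
    have "0 \<le> (C - norm u) * norm b"
      by (auto simp: C_def intro!: mult_nonneg_nonneg sum_nonneg)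
    moreover have "C * norm b = (C - norm u) * norm b + norm u * norm b"
      by (simp add: algebra_simps)
    moreover have "0 \<le> norm u * norm b" by simp
    ultimately have "\<bar>q \<bullet> y\<bar> \<le> C * norm b"
      using lower upper by linarith
    then show ?thesis by (simp add: y(3) b_def)
  qed
  moreover have "0 \<le> C" by (auto simp: C_def intro!: add_nonneg_nonneg sum_nonneg)
  ultimately show thesis using that by blast
qed

lemma norm_matrix_vector_mult_le:
  fixes A :: "real ^ 'n ^ 'm"
  shows "norm (A *v x) \<le> norm A * norm x"
proof -
  have "norm (A *v x) \<le> L2_set (\<lambda>i. norm (A $ i) * norm x) UNIV"
    unfolding norm_vec_def[of "A *v x"]
    by (rule L2_set_mono) (simp_all add: matrix_vector_mul_component Cauchy_Schwarz_ineq2)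
  also have "\<dots> = norm A * norm x"
    by (simp add: norm_vec_def[of A] L2_set_left_distrib)
  finally show ?thesis .
qed

lemma recourse_linear_growth:
  fixes W :: "real ^ 'k ^ 'm" and Z :: "(real ^ 'n) set"
  assumes U: "{u. transpose W *v u \<le> q} \<noteq> {}" "bounded {u. transpose W *v u \<le> q}"
    and "bounded Z"
  obtains C where "0 \<le> C" and "\<And>z \<zeta>. z \<in> Z \<Longrightarrow> \<bar>recourse W q z \<zeta>\<bar> \<le> C * norm \<zeta>"
proof -
  obtain C where C: "0 \<le> C"
    "\<And>z :: real ^ 'n. \<And>\<zeta>. \<bar>recourse W q z \<zeta>\<bar> \<le> C * norm (fst \<zeta> - snd \<zeta> *v z)"
    using recourse_bound[OF U] by blast
  obtain B where B: "0 < B" "\<And>z. z \<in> Z \<Longrightarrow> norm z \<le> B"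
    using \<open>bounded Z\<close> by (auto simp: bounded_pos)
  have "\<bar>recourse W q z \<zeta>\<bar> \<le> C * (1 + B) * norm \<zeta>" if "z \<in> Z" for z \<zeta>
  proof -
    have "norm (snd \<zeta> *v z) \<le> norm (snd \<zeta>) * norm z"
      by (rule norm_matrix_vector_mult_le)
    also have "\<dots> \<le> norm \<zeta> * B"
      using B that norm_snd_le[where x = "fst \<zeta>" and y = "snd \<zeta>"] by (intro mult_mono) auto
    finally have "norm (fst \<zeta> - snd \<zeta> *v z) \<le> (1 + B) * norm \<zeta>"
      using norm_triangle_ineq4[of "fst \<zeta>" "snd \<zeta> *v z"] norm_fst_le[where x = "fst \<zeta>" and y = "snd \<zeta>"]
      by (simp add: algebra_simps)
    then show ?thesis
      using C(2)[of z \<zeta>] mult_left_mono[OF _ C(1)] by (fastforce simp: mult.assoc)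
  qed
  moreover have "0 \<le> C * (1 + B)" using C(1) B(1) by simp
  ultimately show thesis using that by blast
qed

section \<open>Partial sums of i.i.d. variables with negative mean\<close>

text \<open>
  The maximum of \<open>0\<close> and the first \<open>n\<close> partial sums of \<open>y\<close>, computed by splitting off the first term
  rather than the last, so that the recursion speaks of the shifted sequence.
\<close>

primrec running_max :: "nat \<Rightarrow> (nat \<Rightarrow> real) \<Rightarrow> real" where
  "running_max 0 y = 0"
| "running_max (Suc n) y = max 0 (y 0 + running_max n (\<lambda>i. y (Suc i)))"

lemma running_max_nonneg: "0 \<le> running_max n y"
  by (cases n) auto

lemma running_max_Suc_mono: "running_max n y \<le> running_max (Suc n) y"
proof (induction n arbitrary: y)
  case (Suc n)
  show ?case using Suc[of "\<lambda>i. y (Suc i)"] by (simp only: running_max.simps)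
qed simp

lemma sum_le_running_max: "(\<Sum>i<n. y i) \<le> running_max n y"
proof (induction n arbitrary: y)
  case (Suc n)
  show ?case
    unfolding sum.lessThan_Suc_shift using Suc[of "\<lambda>i. y (Suc i)"] by (auto simp: max_def)
qed simp

lemma running_max_le_sum_abs: "running_max n y \<le> (\<Sum>i<n. \<bar>y i\<bar>)"
proof (induction n arbitrary: y)
  case (Suc n)
  have "0 \<le> (\<Sum>i<n. \<bar>y (Suc i)\<bar>)" by (rule sum_nonneg) simp
  then show ?case
    unfolding sum.lessThan_Suc_shift using Suc[of "\<lambda>i. y (Suc i)"] by auto
qed simp

lemma running_max_measurable:
  "running_max n \<in> borel_measurable (Pi\<^sub>M UNIV (\<lambda>_. borel))"
proof (induction n)
  case (Suc n)
  have "(\<lambda>y i. y (Suc i)) \<in> measurable (Pi\<^sub>M UNIV (\<lambda>_. borel)) (Pi\<^sub>M UNIV (\<lambda>_. borel :: real measure))"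
    by (rule measurable_PiM_single') auto
  from measurable_compose[OF this Suc]
  have [measurable]: "(\<lambda>y. running_max n (\<lambda>i. y (Suc i))) \<in> borel_measurable (Pi\<^sub>M UNIV (\<lambda>_. borel))" .
  show ?case by simp
qed simp

text \<open>
  Up to a shift of the index, prepending \<open>s\<close> moves the running maxima by at most \<open>\<bar>s\<bar>\<close>.
\<close>

lemma bdd_above_running_max_case_nat:
  "bdd_above (range (\<lambda>n. running_max n (case_nat s y))) \<longleftrightarrow> bdd_above (range (\<lambda>n. running_max n y))"
proof
  assume "bdd_above (range (\<lambda>n. running_max n (case_nat s y)))"
  then obtain C where "\<And>n. running_max n (case_nat s y) \<le> C"
    by (auto simp: bdd_above_def)
  from this[of "Suc _"] show "bdd_above (range (\<lambda>n. running_max n y))"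
    by (intro bdd_aboveI2[of _ _ "C - s"]) (simp add: le_diff_eq add.commute)
next
  assume "bdd_above (range (\<lambda>n. running_max n y))"
  then obtain C where C: "\<And>n. running_max n y \<le> C"
    by (auto simp: bdd_above_def)
  have "running_max n (case_nat s y) \<le> max 0 (s + C)" for n
    using running_max_Suc_mono[of n "case_nat s y"] C[of n] by auto
  then show "bdd_above (range (\<lambda>n. running_max n (case_nat s y)))"
    by (rule bdd_aboveI2)
qed

lemma running_max_tendsto_infinity:
  assumes "\<not> bdd_above (range (\<lambda>n. running_max n y))"
  shows "filterlim (\<lambda>n. running_max n y) at_top sequentially"
proof -
  have "incseq (\<lambda>n. running_max n y)"
    by (rule incseq_SucI) (rule running_max_Suc_mono)
  then show ?thesis
    using assms unfolding filterlim_at_top eventually_sequentially bdd_above_def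
    by (auto simp: not_le) (meson dual_order.trans incseqD less_le_not_le linorder_not_le)
qed

text \<open>
  Prepending an independent \<open>\<mu>\<close>-distributed term \<open>s\<close> to a sequence \<open>y\<close> with law \<open>S\<close> yields again a
  sequence with law \<open>S\<close>. The proof therefore lives on pairs \<open>(s, y)\<close>, where the independence of the
  first term from the shifted sequence is built in.
\<close>

lemma AE_running_max_bounded:
  fixes \<mu> :: "real measure"
  assumes "prob_space \<mu>" and sets[measurable_cong]: "sets \<mu> = sets borel"
    and int: "integrable \<mu> (\<lambda>x. x)" and neg: "(\<integral>x. x \<partial>\<mu>) < 0"
  shows "AE y in Pi\<^sub>M UNIV (\<lambda>_::nat. \<mu>). bdd_above (range (\<lambda>n. running_max n y))"
proof -
  interpret sequence_space \<mu>
    using assms(1) by (simp add: sequence_space_def product_prob_spaceI)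
  interpret Pair: pair_prob_space \<mu> S ..
  have sets_S[measurable_cong]: "sets S = sets (Pi\<^sub>M UNIV (\<lambda>_. borel))"
    by (rule sets_PiM_cong) (auto simp: sets)
  have F[measurable]: "running_max n \<in> borel_measurable S" for n
    using running_max_measurable by (simp cong: measurable_cong_sets add: sets_S)
  define A where "A = {y. \<not> bdd_above (range (\<lambda>n. running_max n y))}"
  have A_iff: "y \<in> A \<longleftrightarrow> \<not> (\<exists>C::nat. \<forall>n. running_max n y \<le> real C)" for y
    unfolding A_def bdd_above_def by auto (meson order_trans real_arch_simple)
  have "{y \<in> space S. \<not> (\<exists>C::nat. \<forall>n. running_max n y \<le> real C)} \<in> sets S"
    by measurable
  also have "{y \<in> space S. \<not> (\<exists>C::nat. \<forall>n. running_max n y \<le> real C)} = A"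
    by (auto simp: A_iff space_PiM sets_eq_imp_space_eq[OF sets])
  finally have A[measurable]: "A \<in> sets S" .
  have A_case_nat: "case_nat s y \<in> A \<longleftrightarrow> y \<in> A" for s y
    unfolding A_def by (simp add: bdd_above_running_max_case_nat)
  \<comment> \<open>Restricting to \<open>A\<close> keeps stationarity, because \<open>A\<close> is shift-invariant.\<close>
  define H where "H n y = indicator A y * running_max n y" for n y
  have H[measurable]: "H n \<in> borel_measurable S" for n
    unfolding H_def by measurable
  have int_comp: "integrable S (\<lambda>y. y i)" for i
  proof -
    have "integrable (distr S \<mu> (\<lambda>y. y i)) (\<lambda>x. x)"
      using int by (simp add: PiM_component)
    then show ?thesis
      by (subst (asm) integrable_distr_eq) auto
  qed
  have int_H: "integrable S (H n)" for n
  proof (rule Bochner_Integration.integrable_bound)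
    show "integrable S (\<lambda>y. \<Sum>i<n. \<bar>y i\<bar>)"
      by (intro Bochner_Integration.integrable_sum integrable_abs int_comp)
    show "AE y in S. norm (H n y) \<le> norm (\<Sum>i<n. \<bar>y i\<bar>)"
      using running_max_le_sum_abs running_max_nonneg
      by (auto simp: H_def indicator_def abs_of_nonneg sum_nonneg)
  qed simp
  have cn[measurable]: "(\<lambda>(s, y). case_nat s y) \<in> measurable (\<mu> \<Otimes>\<^sub>M S) S"
    by measurable
  have snd_S: "distr (\<mu> \<Otimes>\<^sub>M S) S snd = S"
  proof (rule measure_eqI)
    fix B assume "B \<in> sets (distr (\<mu> \<Otimes>\<^sub>M S) S snd)"
    then have B: "B \<in> sets S" by simp
    then have "snd -` B \<inter> space (\<mu> \<Otimes>\<^sub>M S) = space \<mu> \<times> B"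
      using sets.sets_into_space[OF B] by (auto simp: space_pair_measure)
    then show "emeasure (distr (\<mu> \<Otimes>\<^sub>M S) S snd) B = emeasure S B"
      using B by (simp add: emeasure_distr P.emeasure_pair_measure_Times M.emeasure_space_1)
  qed simp
  \<comment> \<open>On \<open>A\<close>, the increment of the running maximum when \<open>s\<close> is prepended; dominated by \<open>\<bar>s\<bar>\<close>.\<close>
  define g where "g n = (\<lambda>(s, y). indicator A y * max (- running_max n y) s)" for n
  have g_eq: "g n (s, y) = H (Suc n) (case_nat s y) - H n y" for n s y
    by (auto simp: g_def H_def indicator_def A_case_nat max_def)
  have "0 \<le> (\<integral>p. g n p \<partial>(\<mu> \<Otimes>\<^sub>M S))" for n
  proof -
    have "integrable (distr (\<mu> \<Otimes>\<^sub>M S) S (\<lambda>(s, y). case_nat s y)) (H (Suc n))"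
      by (simp only: PiM_iter int_H)
    then have i1: "integrable (\<mu> \<Otimes>\<^sub>M S) (\<lambda>(s, y). H (Suc n) (case_nat s y))"
      by (subst (asm) integrable_distr_eq) (auto simp: split_beta')
    have "integrable (distr (\<mu> \<Otimes>\<^sub>M S) S snd) (H n)"
      by (simp only: snd_S int_H)
    then have i2: "integrable (\<mu> \<Otimes>\<^sub>M S) (\<lambda>(s, y). H n y)"
      by (subst (asm) integrable_distr_eq) (auto simp: split_beta')
    have "(\<integral>y. H n y \<partial>S) \<le> (\<integral>y. H (Suc n) y \<partial>S)"
      using running_max_Suc_mono by (intro integral_mono int_H) (auto simp: H_def indicator_def simp del: running_max.simps)
    also have "(\<integral>y. H (Suc n) y \<partial>S) = (\<integral>y. H (Suc n) y \<partial>distr (\<mu> \<Otimes>\<^sub>M S) S (\<lambda>(s, y). case_nat s y))"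
      by (simp only: PiM_iter)
    also have "\<dots> = (\<integral>(s, y). H (Suc n) (case_nat s y) \<partial>(\<mu> \<Otimes>\<^sub>M S))"
      by (subst integral_distr) (auto simp: split_beta')
    also have "(\<integral>y. H n y \<partial>S) = (\<integral>y. H n y \<partial>distr (\<mu> \<Otimes>\<^sub>M S) S snd)"
      by (simp only: snd_S)
    also have "\<dots> = (\<integral>(s, y). H n y \<partial>(\<mu> \<Otimes>\<^sub>M S))"
      by (subst integral_distr) (auto simp: split_beta')
    finally have "0 \<le> (\<integral>p. (case p of (s, y) \<Rightarrow> H (Suc n) (case_nat s y)) - (case p of (s, y) \<Rightarrow> H n y) \<partial>(\<mu> \<Otimes>\<^sub>M S))"
      by (subst Bochner_Integration.integral_diff[OF i1 i2]) simp
    also have "\<dots> = (\<integral>p. g n p \<partial>(\<mu> \<Otimes>\<^sub>M S))"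
      by (rule Bochner_Integration.integral_cong) (auto simp: g_eq)
    finally show ?thesis .
  qed
  moreover have "integrable (\<mu> \<Otimes>\<^sub>M S) (\<lambda>p. \<bar>fst p\<bar>)"
  proof -
    have "integrable (distr (\<mu> \<Otimes>\<^sub>M S) \<mu> fst) (\<lambda>x. x)"
      using int by (simp add: prob_space.distr_pair_fst[OF P.prob_space_axioms])
    then show ?thesis
      by (subst (asm) integrable_distr_eq) auto
  qed
  then have dom: "integrable (\<mu> \<Otimes>\<^sub>M S) (\<lambda>(s, y). indicator A y * s)"
      "(\<lambda>n. \<integral>p. g n p \<partial>(\<mu> \<Otimes>\<^sub>M S)) \<longlonglongrightarrow> (\<integral>(s, y). indicator A y * s \<partial>(\<mu> \<Otimes>\<^sub>M S))"
  proof -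
    let ?w = "\<lambda>p :: real \<times> (nat \<Rightarrow> real). \<bar>fst p\<bar>"
    assume w: "integrable (\<mu> \<Otimes>\<^sub>M S) ?w"
    have m1: "(\<lambda>(s, y). indicator A y * s) \<in> borel_measurable (\<mu> \<Otimes>\<^sub>M S)"
      and m2: "g n \<in> borel_measurable (\<mu> \<Otimes>\<^sub>M S)" for n
      unfolding g_def by measurable
    have lim: "AE p in \<mu> \<Otimes>\<^sub>M S. (\<lambda>n. g n p) \<longlonglongrightarrow> (case p of (s, y) \<Rightarrow> indicator A y * s)"
    proof (rule AE_I2, clarify)
      fix s y
      have "eventually (\<lambda>n. g n (s, y) = indicator A y * s) sequentially" 
      proof (cases "y \<in> A")
        case True
        then have "eventually (\<lambda>n. - s \<le> running_max n y) sequentially"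
          using running_max_tendsto_infinity[of y] by (auto simp: A_def filterlim_at_top)
        then show ?thesis by eventually_elim (auto simp: g_def max_def)
      qed (auto simp: g_def)
      then show "(\<lambda>n. g n (s, y)) \<longlonglongrightarrow> indicator A y * s"
        by (rule tendsto_eventually)
    qed
    have bd: "AE p in \<mu> \<Otimes>\<^sub>M S. norm (g n p) \<le> ?w p" for n
      using running_max_nonneg[of n] by (auto simp: g_def indicator_def max_def abs_if intro!: AE_I2)
        (smt (verit) running_max_nonneg)+
    show "integrable (\<mu> \<Otimes>\<^sub>M S) (\<lambda>(s, y). indicator A y * s)"
      using integrable_dominated_convergence[OF m1 m2 w lim bd] .
    show "(\<lambda>n. \<integral>p. g n p \<partial>(\<mu> \<Otimes>\<^sub>M S)) \<longlonglongrightarrow> (\<integral>(s, y). indicator A y * s \<partial>(\<mu> \<Otimes>\<^sub>M S))"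
      using integral_dominated_convergence[OF m1 m2 w lim bd] .
  qed
  ultimately have "0 \<le> (\<integral>(s, y). indicator A y * s \<partial>(\<mu> \<Otimes>\<^sub>M S))"
    by (intro LIMSEQ_le_const[OF dom(2)]) auto
  also have "\<dots> = (\<integral>s. (\<integral>y. indicator A y * s \<partial>S) \<partial>\<mu>)"
    using Pair.integral_fst'[OF dom(1)] by simp
  also have "\<dots> = measure S A * (\<integral>s. s \<partial>\<mu>)"
    by simp
  finally have "measure S A = 0"
    using neg by (smt (verit) measure_nonneg mult_pos_neg)
  then have "AE y in S. y \<notin> A"
    by (simp add: P.prob_eq_0)
  then show ?thesis
    by (auto simp: A_def)
qed

lemma (in prob_space) indep_vars_reindex:
  assumes indep: "indep_vars M' X (f ` I)" and inj: "inj_on f I" and "I \<noteq> {}"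
  shows "indep_vars (\<lambda>i. M' (f i)) (\<lambda>i. X (f i)) I"
proof -
  have X[measurable]: "X j \<in> measurable M (M' j)" if "j \<in> f ` I" for j
    using indep that by (auto simp: indep_vars_def)
  have "(\<Pi>\<^sub>M i\<in>I. distr M (M' (f i)) (X (f i)))
      = distr (\<Pi>\<^sub>M j\<in>f ` I. distr M (M' j) (X j)) (\<Pi>\<^sub>M i\<in>I. distr M (M' (f i)) (X (f i)))
          (\<lambda>\<omega>. \<lambda>i\<in>I. \<omega> (f i))"
    using X by (intro distr_PiM_reindex[OF _ inj, symmetric] prob_space_distr) auto
  also have "(\<Pi>\<^sub>M j\<in>f ` I. distr M (M' j) (X j))
      = distr M (\<Pi>\<^sub>M j\<in>f ` I. M' j) (\<lambda>\<omega>. \<lambda>j\<in>f ` I. X j \<omega>)"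
    using indep X \<open>I \<noteq> {}\<close> by (subst (asm) indep_vars_iff_distr_eq_PiM') auto
  also have "distr \<dots> (\<Pi>\<^sub>M i\<in>I. distr M (M' (f i)) (X (f i))) (\<lambda>\<omega>. \<lambda>i\<in>I. \<omega> (f i))
      = distr \<dots> (\<Pi>\<^sub>M i\<in>I. M' (f i)) (\<lambda>\<omega>. \<lambda>i\<in>I. \<omega> (f i))"
    by (intro distr_cong refl sets_PiM_cong) auto
  also have "\<dots> = distr M (\<Pi>\<^sub>M i\<in>I. M' (f i)) (\<lambda>\<omega>. \<lambda>i\<in>I. X (f i) \<omega>)"
    by (subst distr_distr) (auto simp: comp_def intro!: distr_cong)
  finally show ?thesis
    using X \<open>I \<noteq> {}\<close> by (subst indep_vars_iff_distr_eq_PiM') auto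
qed

lemma (in prob_space) AE_partial_sums_bounded_above:
  fixes Y :: "nat \<Rightarrow> 'a \<Rightarrow> real"
  assumes indep: "indep_vars (\<lambda>_. borel) Y UNIV"
    and ident: "\<And>n. distr M borel (Y n) = distr M borel V"
    and int: "integrable M V" and neg: "expectation V < 0"
  shows "AE \<omega> in M. bdd_above (range (\<lambda>n. \<Sum>i<n. Y i \<omega>))"
proof -
  have V[measurable]: "V \<in> borel_measurable M" using int by auto
  have Y[measurable]: "Y n \<in> borel_measurable M" for n
    using indep by (auto simp: indep_vars_def)
  have "distr M (Pi\<^sub>M UNIV (\<lambda>_. borel)) (\<lambda>\<omega>. \<lambda>i\<in>UNIV. Y i \<omega>) = Pi\<^sub>M UNIV (\<lambda>i. distr M borel (Y i))"
    using indep indep_vars_iff_distr_eq_PiM'[of UNIV Y "\<lambda>_. borel"] by simp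
  then have law: "distr M (Pi\<^sub>M UNIV (\<lambda>_. borel)) (\<lambda>\<omega> i. Y i \<omega>) = Pi\<^sub>M UNIV (\<lambda>_. distr M borel V)"
    by (simp add: ident restrict_UNIV)
  have "AE y in Pi\<^sub>M UNIV (\<lambda>_::nat. distr M borel V). bdd_above (range (\<lambda>n. running_max n y))"
  proof (rule AE_running_max_bounded)
    show "prob_space (distr M borel V)" by (rule prob_space_distr) simp
    show "integrable (distr M borel V) (\<lambda>x. x)" using int by (simp add: integrable_distr_eq)
    show "(\<integral>x. x \<partial>distr M borel V) < 0" using neg by (simp add: integral_distr)
  qed simp
  then have "AE \<omega> in M. bdd_above (range (\<lambda>n. running_max n (\<lambda>i. Y i \<omega>)))"
    unfolding law[symmetric] by (rule AE_distrD[rotated]) (rule measurable_PiM_single', auto)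
  then show ?thesis
  proof eventually_elim
    case (elim \<omega>)
    then obtain C where "\<And>n. running_max n (\<lambda>i. Y i \<omega>) \<le> C" by (auto simp: bdd_above_def)
    then show ?case
      using sum_le_running_max[of "\<lambda>i. Y i \<omega>"] by (intro bdd_aboveI2[of _ _ C]) (rule order_trans)
  qed
qed

text \<open>
  Adding half of \<open>- expectation V\<close> to every term leaves the mean negative, so the shifted partial sums
  are still bounded above, whereas the total shift grows linearly.
\<close>

lemma (in prob_space) AE_eventually_partial_sums_negative:
  fixes Y :: "nat \<Rightarrow> 'a \<Rightarrow> real"
  assumes indep: "indep_vars (\<lambda>_. borel) Y {1..}"
    and ident: "\<And>n. 1 \<le> n \<Longrightarrow> distr M borel (Y n) = distr M borel V"
    and int: "integrable M V" and neg: "expectation V < 0"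
  shows "AE \<omega> in M. \<forall>\<^sub>F N in sequentially. (\<Sum>n=1..N. Y n \<omega>) < 0"
proof -
  have V[measurable]: "V \<in> borel_measurable M" using int by auto
  have Y[measurable]: "Y n \<in> borel_measurable M" if "1 \<le> n" for n
    using indep that by (auto simp: indep_vars_def)
  define \<epsilon> where "\<epsilon> = - expectation V / 2"
  have "\<epsilon> > 0" using neg by (simp add: \<epsilon>_def)
  have "Suc ` UNIV = {1..}"
    by (auto simp: image_iff Suc_le_eq gr0_conv_Suc)
  then have "indep_vars (\<lambda>_. borel) (\<lambda>i \<omega>. Y (Suc i) \<omega>) UNIV"
    using indep_vars_reindex[of "\<lambda>_. borel" Y Suc UNIV] indep
    by simp
  then have "indep_vars (\<lambda>_. borel) (\<lambda>i \<omega>. Y (Suc i) \<omega> + \<epsilon>) UNIV"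
    by (rule indep_vars_compose2[where Y = "\<lambda>_ y. y + \<epsilon>"]) simp
  moreover have "distr M borel (\<lambda>\<omega>. Y (Suc n) \<omega> + \<epsilon>) = distr M borel (\<lambda>\<omega>. V \<omega> + \<epsilon>)" for n
    using arg_cong[OF ident[of "Suc n"], of "\<lambda>D. distr D borel (\<lambda>y. y + \<epsilon>)"]
    by (simp add: distr_distr comp_def)
  ultimately have "AE \<omega> in M. bdd_above (range (\<lambda>n. \<Sum>i<n. Y (Suc i) \<omega> + \<epsilon>))"
    by (rule AE_partial_sums_bounded_above) (use int neg in \<open>auto simp: prob_space \<epsilon>_def\<close>)
  then show ?thesis
  proof eventually_elim
    case (elim \<omega>)
    then obtain C where C: "\<And>n. (\<Sum>i<n. Y (Suc i) \<omega> + \<epsilon>) \<le> C" by (auto simp: bdd_above_def)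
    have "\<forall>\<^sub>F N in sequentially. C / \<epsilon> < real N"
      using filterlim_real_sequentially by (simp add: filterlim_at_top_dense)
    then show ?case
    proof eventually_elim
      case (elim N)
      have "(\<Sum>n=1..N. Y n \<omega>) + real N * \<epsilon> \<le> C"
        using C[of N] by (simp add: sum.distrib sum.atLeast1_atMost_eq)
      then show ?case using elim \<open>\<epsilon> > 0\<close> by (simp add: divide_less_eq)
    qed
  qed
qed

lemma (in prob_space) partial_sums_nonneg_exp_bound:
  fixes Y :: "nat \<Rightarrow> 'a \<Rightarrow> real"
  assumes indep: "indep_vars (\<lambda>_. borel) Y {1..}"
    and ident: "\<And>n. 1 \<le> n \<Longrightarrow> distr M borel (Y n) = distr M borel V"
    and V: "V \<in> borel_measurable M" and bounded: "AE \<omega> in M. \<bar>V \<omega>\<bar> \<le> B"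
    and neg: "expectation V < 0"
  shows "\<exists>\<beta>>0. \<forall>N\<ge>1. prob {\<omega> \<in> space M. 0 \<le> (\<Sum>n=1..N. Y n \<omega>)} \<le> exp (- real N * \<beta>)"
proof -
  define b where "b = \<bar>B\<bar> + 1"
  define \<beta> where "\<beta> = 2 * (expectation V)\<^sup>2 / (2 * b)\<^sup>2"
  have "b > 0" by (simp add: b_def)
  have "prob {\<omega> \<in> space M. 0 \<le> (\<Sum>n=1..N. Y n \<omega>)} \<le> exp (- real N * \<beta>)" if "1 \<le> N" for N
  proof -
    interpret Hoeffding_ineq_iid M "{1..N}" Y V "- b" b "expectation V"
    proof unfold_locales
      show "indep_vars (\<lambda>_. borel) Y {1..N}"
        by (rule indep_vars_subset[OF indep]) auto
      show "AE \<omega> in M. V \<omega> \<in> {- b..b}"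
        using bounded by eventually_elim (auto simp: b_def)
    qed (use ident V in auto)
    have "prob {\<omega> \<in> space M. 0 \<le> (\<Sum>n=1..N. Y n \<omega>)}
        = prob {\<omega> \<in> space M. expectation V + (- expectation V) \<le> (\<Sum>n=1..N. Y n \<omega>) / real (card {1..N})}"
      using that by (intro arg_cong[of _ _ prob]) (auto simp: zero_le_divide_iff)
    also have "\<dots> \<le> exp (- 2 * real (card {1..N}) * (- expectation V)\<^sup>2 / (b - (- b))\<^sup>2)"
      by (rule Hoeffding_ineq_ge') (use neg \<open>b > 0\<close> that in auto)
    finally show ?thesis by (simp add: \<beta>_def algebra_simps)
  qed
  moreover have "\<beta> > 0" using neg \<open>b > 0\<close> by (simp add: \<beta>_def)
  ultimately show ?thesis by blast
qed

section \<open>Comparing two expected costs by sampling\<close>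

text \<open>
  The value \<open>ext_expectation M Y'\<close> is finite, being below another one and bounded below by the
  integral of \<open>L\<close>. If all truncations of \<open>Y\<close> had mean at most that of \<open>Y'\<close>, then by monotone
  convergence \<open>Y\<close> would be integrable with the same bound on its mean. This covers a variable \<open>Y\<close> of infinite
  mean as well.
\<close>

lemma integrable_truncation_separates:
  fixes Y Y' :: "'a \<Rightarrow> real"
  assumes "finite_measure M" and [measurable]: "Y \<in> borel_measurable M" "Y' \<in> borel_measurable M"
    and L: "integrable M L" "AE \<omega> in M. L \<omega> \<le> Y \<omega>" "AE \<omega> in M. L \<omega> \<le> Y' \<omega>"
    and less: "ext_expectation M Y' < ext_expectation M Y"
  shows "integrable M Y'"
    and "\<exists>c. integrable M (\<lambda>\<omega>. min (Y \<omega>) c) \<and> integral\<^sup>L M Y' < (\<integral>\<omega>. min (Y \<omega>) c \<partial>M)"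
proof -
  interpret finite_measure M by fact
  have neg_part: "(\<integral>\<^sup>+\<omega>. ennreal (- Y' \<omega>) \<partial>M) < \<infinity>"
  proof -
    have "(\<integral>\<^sup>+\<omega>. ennreal (- Y' \<omega>) \<partial>M) \<le> (\<integral>\<^sup>+\<omega>. ennreal (norm (L \<omega>)) \<partial>M)"
      using L(3) by (intro nn_integral_mono_AE) (auto elim!: eventually_mono intro!: ennreal_leI)
    also have "\<dots> < \<infinity>" using L(1) by (simp add: integrable_iff_bounded)
    finally show ?thesis .
  qed
  have "(\<integral>\<^sup>+\<omega>. ennreal (Y' \<omega>) \<partial>M) \<noteq> \<infinity>"
  proof
    assume "(\<integral>\<^sup>+\<omega>. ennreal (Y' \<omega>) \<partial>M) = \<infinity>"
    then have "ext_expectation M Y' = \<infinity>"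
      using neg_part by (cases "\<integral>\<^sup>+\<omega>. ennreal (- Y' \<omega>) \<partial>M") (auto simp: ext_expectation_def enn2ereal_ennreal)
    then show False using less by simp
  qed
  then show int: "integrable M Y'"
    using neg_part by (simp add: real_integrable_def)
  show "\<exists>c. integrable M (\<lambda>\<omega>. min (Y \<omega>) c) \<and> integral\<^sup>L M Y' < (\<integral>\<omega>. min (Y \<omega>) c \<partial>M)"
  proof (rule ccontr)
    assume neg: "\<not> ?thesis"
    have trunc: "integrable M (\<lambda>\<omega>. min (Y \<omega>) (real k))" for k
    proof (rule Bochner_Integration.integrable_bound)
      show "integrable M (\<lambda>\<omega>. \<bar>L \<omega>\<bar> + real k)" using L(1) by simp
      show "AE \<omega> in M. norm (min (Y \<omega>) (real k)) \<le> norm (\<bar>L \<omega>\<bar> + real k)"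
        using L(2) by eventually_elim auto
    qed simp
    have le: "(\<integral>\<omega>. min (Y \<omega>) (real k) \<partial>M) \<le> integral\<^sup>L M Y'" for k
      using neg trunc[of k] by (meson not_le)
    have "incseq (\<lambda>k. \<integral>\<omega>. min (Y \<omega>) (real k) \<partial>M)"
      by (intro incseq_SucI integral_mono trunc) auto
    then obtain l where l: "(\<lambda>k. \<integral>\<omega>. min (Y \<omega>) (real k) \<partial>M) \<longlonglongrightarrow> l"
      using le incseq_convergent by metis
    then have "l \<le> integral\<^sup>L M Y'"
      using le by (intro LIMSEQ_le_const2) auto
    have mono: "AE \<omega> in M. mono (\<lambda>k. min (Y \<omega>) (real k))"
      by (auto intro!: monoI)
    have lim: "AE \<omega> in M. (\<lambda>k. min (Y \<omega>) (real k)) \<longlonglongrightarrow> Y \<omega>"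
    proof (rule AE_I2)
      fix \<omega>
      have "\<forall>\<^sub>F k in sequentially. Y \<omega> \<le> real k"
        using filterlim_real_sequentially by (simp add: filterlim_at_top)
      then have "\<forall>\<^sub>F k in sequentially. min (Y \<omega>) (real k) = Y \<omega>"
        by eventually_elim simp
      then show "(\<lambda>k. min (Y \<omega>) (real k)) \<longlonglongrightarrow> Y \<omega>" by (rule tendsto_eventually)
    qed
    have "integrable M Y" "integral\<^sup>L M Y = l"
      using integrable_monotone_convergence[OF trunc mono lim l]
        integral_monotone_convergence[OF trunc mono lim l] by auto
    then show False
      using less \<open>l \<le> _\<close> int by (simp add: ext_expectation_integrable)
  qed
qed

text \<open>
  Truncating \<open>g\<close> at \<open>c\<close> only lowers its sample sums, so it is enough to beat the truncated cost, which
  has a finite mean.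
\<close>

lemma (in prob_space) AE_eventually_sample_cost_less:
  fixes D :: "nat \<Rightarrow> 'a \<Rightarrow> 'd::topological_space"
  assumes indep: "indep_vars (\<lambda>_. borel) D {1..}"
    and ident: "\<And>n. 1 \<le> n \<Longrightarrow> distr M borel (D n) = distr M borel D0"
    and D0[measurable]: "D0 \<in> borel_measurable M"
    and g[measurable]: "g \<in> borel_measurable borel" and g'[measurable]: "g' \<in> borel_measurable borel"
    and L: "integrable M L" "AE \<omega> in M. L \<omega> \<le> g (D0 \<omega>)" "AE \<omega> in M. L \<omega> \<le> g' (D0 \<omega>)"
    and less: "ext_expectation M (\<lambda>\<omega>. g' (D0 \<omega>)) < ext_expectation M (\<lambda>\<omega>. g (D0 \<omega>))"
  shows "AE \<omega> in M. \<forall>\<^sub>F N in sequentially. (\<Sum>n=1..N. g' (D n \<omega>)) < (\<Sum>n=1..N. g (D n \<omega>))"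
proof -
  note sep = integrable_truncation_separates[OF finite_measure_axioms _ _ L less]
  have int: "integrable M (\<lambda>\<omega>. g' (D0 \<omega>))" using sep(1) by simp
  obtain c where c: "integrable M (\<lambda>\<omega>. min (g (D0 \<omega>)) c)"
    "expectation (\<lambda>\<omega>. g' (D0 \<omega>)) < expectation (\<lambda>\<omega>. min (g (D0 \<omega>)) c)"
    using sep(2) by auto
  define \<phi> where "\<phi> d = g' d - min (g d) c" for d
  have \<phi>[measurable]: "\<phi> \<in> borel_measurable borel"
    unfolding \<phi>_def[abs_def] by measurable
  have D[measurable]: "D n \<in> borel_measurable M" if "1 \<le> n" for n
    using indep that by (auto simp: indep_vars_def)
  have "AE \<omega> in M. \<forall>\<^sub>F N in sequentially. (\<Sum>n=1..N. \<phi> (D n \<omega>)) < 0"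
  proof (rule AE_eventually_partial_sums_negative)
    show "indep_vars (\<lambda>_. borel) (\<lambda>n \<omega>. \<phi> (D n \<omega>)) {1..}"
      by (rule indep_vars_compose2[OF indep]) simp
    show "distr M borel (\<lambda>\<omega>. \<phi> (D n \<omega>)) = distr M borel (\<lambda>\<omega>. \<phi> (D0 \<omega>))" if "1 \<le> n" for n
      using arg_cong[OF ident[OF that], of "\<lambda>\<nu>. distr \<nu> borel \<phi>"] that
      by (simp add: distr_distr comp_def)
    show "integrable M (\<lambda>\<omega>. \<phi> (D0 \<omega>))" "expectation (\<lambda>\<omega>. \<phi> (D0 \<omega>)) < 0"
      using int c by (auto simp: \<phi>_def)
  qed
  then show ?thesis
  proof eventually_elim
    case (elim \<omega>)
    then show ?case
    proof eventually_elim
      case (elim N)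
      have "(\<Sum>n=1..N. g' (D n \<omega>) - g (D n \<omega>)) \<le> (\<Sum>n=1..N. \<phi> (D n \<omega>))"
        by (intro sum_mono) (simp add: \<phi>_def)
      then show ?case using elim by (simp add: sum_subtractf)
    qed
  qed
qed

lemma (in prob_space) sample_cost_error_exp_bound:
  fixes D :: "nat \<Rightarrow> 'a \<Rightarrow> 'd::topological_space"
  assumes indep: "indep_vars (\<lambda>_. borel) D {1..}"
    and ident: "\<And>n. 1 \<le> n \<Longrightarrow> distr M borel (D n) = distr M borel D0"
    and D0[measurable]: "D0 \<in> borel_measurable M"
    and g[measurable]: "g \<in> borel_measurable borel" and g'[measurable]: "g' \<in> borel_measurable borel"
    and bounded: "AE \<omega> in M. \<bar>g (D0 \<omega>)\<bar> \<le> B" "AE \<omega> in M. \<bar>g' (D0 \<omega>)\<bar> \<le> B"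
    and less: "ext_expectation M (\<lambda>\<omega>. g' (D0 \<omega>)) < ext_expectation M (\<lambda>\<omega>. g (D0 \<omega>))"
  shows "\<exists>\<beta>>0. \<forall>N\<ge>1. prob {\<omega> \<in> space M. (\<Sum>n=1..N. g (D n \<omega>)) \<le> (\<Sum>n=1..N. g' (D n \<omega>))}
    \<le> exp (- real N * \<beta>)"
proof -
  have int: "integrable M (\<lambda>\<omega>. g (D0 \<omega>))" "integrable M (\<lambda>\<omega>. g' (D0 \<omega>))"
    using bounded by (auto intro!: integrable_const_bound)
  have D[measurable]: "D n \<in> borel_measurable M" if "1 \<le> n" for n
    using indep that by (auto simp: indep_vars_def)
  define \<phi> where "\<phi> d = g' d - g d" for d
  have \<phi>[measurable]: "\<phi> \<in> borel_measurable borel"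
    unfolding \<phi>_def[abs_def] by measurable
  have "\<exists>\<beta>>0. \<forall>N\<ge>1. prob {\<omega> \<in> space M. 0 \<le> (\<Sum>n=1..N. \<phi> (D n \<omega>))} \<le> exp (- real N * \<beta>)"
  proof (rule partial_sums_nonneg_exp_bound)
    show "indep_vars (\<lambda>_. borel) (\<lambda>n \<omega>. \<phi> (D n \<omega>)) {1..}"
      by (rule indep_vars_compose2[OF indep]) simp
    show "distr M borel (\<lambda>\<omega>. \<phi> (D n \<omega>)) = distr M borel (\<lambda>\<omega>. \<phi> (D0 \<omega>))" if "1 \<le> n" for n
      using arg_cong[OF ident[OF that], of "\<lambda>\<nu>. distr \<nu> borel \<phi>"] that
      by (simp add: distr_distr comp_def)
    show "AE \<omega> in M. \<bar>\<phi> (D0 \<omega>)\<bar> \<le> 2 * B"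
      using bounded by eventually_elim (auto simp: \<phi>_def)
    show "expectation (\<lambda>\<omega>. \<phi> (D0 \<omega>)) < 0"
      using int less by (simp add: \<phi>_def ext_expectation_integrable)
  qed simp
  then show ?thesis by (simp add: \<phi>_def sum_subtractf)
qed

section \<open>Support of a random variable\<close>

text \<open>
  In a second countable space, the complement of the support is covered by the countably many basic
  open sets of measure zero.
\<close>

lemma (in prob_space) AE_in_rv_support:
  fixes Y :: "'a \<Rightarrow> 'b :: second_countable_topology"
  assumes [measurable]: "Y \<in> borel_measurable M"
  shows "AE \<omega> in M. Y \<omega> \<in> rv_support M Y"
proof -
  obtain \<B> :: "'b set set" where \<B>: "countable \<B>" "topological_basis \<B>"
    using ex_countable_basis by blast
  define \<N> where "\<N> = {B \<in> \<B>. measure (distr M borel Y) B = 0}"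
  have "countable \<N>" using \<B>(1) by (simp add: \<N>_def)
  moreover have "AE \<omega> in M. Y \<omega> \<notin> B" if "B \<in> \<N>" for B
  proof -
    have [measurable]: "B \<in> sets borel"
      using that topological_basis_open[OF \<B>(2)] by (auto simp: \<N>_def)
    have "prob (Y -` B \<inter> space M) = 0" using that by (simp add: \<N>_def measure_distr)
    then have "AE \<omega> in M. \<omega> \<notin> Y -` B \<inter> space M" by (simp add: prob_eq_0)
    then show ?thesis using AE_space by eventually_elim auto
  qed
  ultimately have "AE \<omega> in M. \<forall>B\<in>\<N>. Y \<omega> \<notin> B" by (simp add: AE_ball_countable)
  then show ?thesis
  proof eventually_elim
    case (elim \<omega>)
    show ?case unfolding rv_support_def
    proof (intro CollectI allI impI)
      fix V assume "open V \<and> Y \<omega> \<in> V"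
      then obtain B where B: "B \<in> \<B>" "Y \<omega> \<in> B" "B \<subseteq> V"
        using topological_basisE[OF \<B>(2)] by metis
      then have "measure (distr M borel Y) B \<noteq> 0" using elim by (auto simp: \<N>_def)
      moreover have "measure (distr M borel Y) B \<le> measure (distr M borel Y) V"
        using \<open>open V \<and> _\<close> B(3)
        by (intro finite_measure.finite_measure_mono prob_space.axioms(1)[OF prob_space_distr]) auto
      ultimately show "measure (distr M borel Y) V > 0"
        using measure_nonneg[of "distr M borel Y" B] by linarith
    qed
  qed
qed

section \<open>First-stage costs and one-scenario solutions\<close>

lemma scenario_solution_in:
  assumes "\<exists>z. is_arg_min (\<lambda>z. total_cost f W q z \<zeta>) (\<lambda>z. z \<in> Z) z"
  shows "scenario_solution Z f W q \<zeta> \<in> Z"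
proof -
  have "is_arg_min (\<lambda>z. total_cost f W q z \<zeta>) (\<lambda>z. z \<in> Z) (scenario_solution Z f W q \<zeta>)"
    unfolding scenario_solution_def arg_min_on_def arg_min_def using assms by (rule someI_ex)
  then show ?thesis by (simp add: is_arg_min_def)
qed

text \<open>
  At the zero scenario the growth bound makes the recourse cost vanish, so a solution of that
  one-scenario problem minimises \<open>f\<close> over \<open>Z\<close>.
\<close>

lemma first_stage_cost_bounded_below:
  fixes W :: "real ^ 'k ^ 'm" and Z :: "(real ^ 'n) set"
  assumes C: "\<And>z (\<zeta> :: ('m, 'n) scenario). z \<in> Z \<Longrightarrow> \<bar>recourse W q z \<zeta>\<bar> \<le> C * norm \<zeta>"
    and "\<exists>z. is_arg_min (\<lambda>z. total_cost f W q z (0 :: ('m, 'n) scenario)) (\<lambda>z. z \<in> Z) z"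
  shows "bdd_below (f ` Z)"
proof -
  obtain z0 where "is_arg_min (\<lambda>z. total_cost f W q z (0 :: ('m, 'n) scenario)) (\<lambda>z. z \<in> Z) z0"
    using assms(2) by blast
  moreover have "total_cost f W q z (0 :: ('m, 'n) scenario) = f z" if "z \<in> Z" for z
    using C[OF that, of 0] by (simp add: total_cost_def)
  ultimately show ?thesis
    by (intro bdd_belowI2[of _ "f z0"]) (force simp: is_arg_min_linorder)
qed

lemma convex_bounded_above_on_bounded:
  fixes f :: "'a::euclidean_space \<Rightarrow> real"
  assumes "convex_on UNIV f" and "bounded Z"
  shows "bdd_above (f ` Z)"
proof -
  have "continuous_on (closure Z) f"
    using convex_on_continuous[OF open_UNIV assms(1)] by (rule continuous_on_subset) simp
  moreover have "compact (closure Z)" using assms(2) by simp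
  ultimately have "bdd_above (f ` closure Z)"
    by (intro bounded_imp_bdd_above compact_imp_bounded compact_continuous_image)
  then show ?thesis by (rule bdd_above_mono) (use closure_subset in blast)
qed

section \<open>Consistency of the empirical parameter choice\<close>

theorem theorem3:
  fixes M :: "'w measure"
    and X :: "'w \<Rightarrow> real ^ 's"
    and \<xi> :: "'w \<Rightarrow> ('m::finite, 'n::finite) scenario"
    and Xs :: "nat \<Rightarrow> 'w \<Rightarrow> real ^ 's"
    and \<xi>s :: "nat \<Rightarrow> 'w \<Rightarrow> ('m, 'n) scenario"
    and D Z :: "(real ^ 'n) set"
    and f :: "real ^ 'n \<Rightarrow> real"
    and W :: "real ^ 'k ^ 'm" and q :: "real ^ 'k"
    and \<Theta> :: "'p set"
    and \<Psi> :: "'p \<Rightarrow> real ^ 's \<Rightarrow> ('m, 'n) scenario"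
    and \<theta>_opt :: "nat \<Rightarrow> 'w \<Rightarrow> 'p"
  assumes "prob_space M"
    and rv: "(\<lambda>\<omega>. (X \<omega>, \<xi> \<omega>)) \<in> borel_measurable M"
    and convex: "convex Z" "convex_on D f" "Z \<subseteq> D"
    and nonempty: "Z \<noteq> {}" "rel_interior D \<noteq> {}"
    and dual: "{u. transpose W *v u \<le> q} \<noteq> {}" "bounded {u. transpose W *v u \<le> q}"
    and unique: "\<forall>\<zeta>. \<exists>!z. is_arg_min (\<lambda>z. total_cost f W q z \<zeta>) (\<lambda>z. z \<in> Z) z"
    and indep: "prob_space.indep_vars M (\<lambda>_. borel) (\<lambda>n \<omega>. (Xs n \<omega>, \<xi>s n \<omega>)) {1..}"
    and ident: "\<forall>n\<ge>1. distr M borel (\<lambda>\<omega>. (Xs n \<omega>, \<xi>s n \<omega>)) = distr M borel (\<lambda>\<omega>. (X \<omega>, \<xi> \<omega>))"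
    and integrable: "integrable M \<xi>"
    and bounded: "bounded Z"
    and \<Theta>: "finite \<Theta>" "\<Theta> \<noteq> {}"
    and cost_measurable: "\<forall>\<theta>\<in>\<Theta>.
      (\<lambda>(x, \<zeta>). total_cost f W q (forecast_policy Z f W q \<Psi> \<theta> x) \<zeta>)
        \<in> borel_measurable borel"
    and \<theta>_opt_measurable: "\<forall>N\<ge>1. \<theta>_opt N \<in> measurable M (count_space \<Theta>)"
    and \<theta>_opt: "\<forall>N\<ge>1. \<forall>\<omega>\<in>space M. is_arg_min
      (empirical_cost Z f W q \<Psi> (\<lambda>n. Xs n \<omega>) (\<lambda>n. \<xi>s n \<omega>) N) (\<lambda>\<theta>. \<theta> \<in> \<Theta>) (\<theta>_opt N \<omega>)"
  shows "(AE \<omega> in M. \<forall>\<^sub>F N in sequentially.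
            \<theta>_opt N \<omega> \<in> optimal_parameters M X \<xi> Z f W q \<Psi> \<Theta>) \<and>
         (bounded (rv_support M \<xi>) \<and> (D = UNIV \<or> bdd_above (f ` Z)) \<longrightarrow>
            (\<exists>K>0. \<exists>\<beta>>0. \<forall>N\<ge>1.
              measure M {\<omega> \<in> space M. \<theta>_opt N \<omega> \<notin> optimal_parameters M X \<xi> Z f W q \<Psi> \<Theta>}
                \<le> K * exp (- real N * \<beta>)))"
proof -
  interpret prob_space M by fact
  define g where "g \<theta> = (\<lambda>(x, \<zeta>). total_cost f W q (forecast_policy Z f W q \<Psi> \<theta> x) \<zeta>)" for \<theta>
  define S where "S = optimal_parameters M X \<xi> Z f W q \<Psi> \<Theta>"
  define D0 where "D0 = (\<lambda>\<omega>. (X \<omega>, \<xi> \<omega>))"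
  define Ds where "Ds n \<omega> = (Xs n \<omega>, \<xi>s n \<omega>)" for n \<omega>
  have g_meas: "g \<theta> \<in> borel_measurable borel" if "\<theta> \<in> \<Theta>" for \<theta>
    using cost_measurable that by (auto simp: g_def)
  have D0: "D0 \<in> borel_measurable M" using rv by (simp add: D0_def)
  have indep': "indep_vars (\<lambda>_. borel) Ds {1..}"
    using indep by (simp add: Ds_def[abs_def])
  have ident': "distr M borel (Ds n) = distr M borel D0" if "1 \<le> n" for n
    using ident that by (simp add: Ds_def[abs_def] D0_def)
  obtain C where C: "0 \<le> C"
    "\<And>z (\<zeta> :: ('m, 'n) scenario). z \<in> Z \<Longrightarrow> \<bar>recourse W q z \<zeta>\<bar> \<le> C * norm \<zeta>"
    using recourse_linear_growth[OF dual bounded] by blast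
  have solvable: "\<exists>z. is_arg_min (\<lambda>z. total_cost f W q z \<zeta>) (\<lambda>z. z \<in> Z) z" for \<zeta>
    using unique by blast
  have "bdd_below (f ` Z)"
    by (rule first_stage_cost_bounded_below[OF C(2) solvable])
  then obtain a where a: "\<And>z. z \<in> Z \<Longrightarrow> a \<le> f z"
    by (auto simp: bdd_below_def)
  have policy_in: "forecast_policy Z f W q \<Psi> \<theta> x \<in> Z" for \<theta> x
    unfolding forecast_policy_def by (rule scenario_solution_in[OF solvable])
  \<comment> \<open>The integrable lower bound shared by all policies.\<close>
  have g_lower: "a - C * norm \<zeta> \<le> g \<theta> (x, \<zeta>)" for \<theta> x \<zeta>
    using a[OF policy_in, of \<theta> x] C(2)[OF policy_in, of \<theta> x \<zeta>]
    by (simp add: g_def total_cost_def)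
  have cost_eq: "policy_cost M X \<xi> f W q (forecast_policy Z f W q \<Psi> \<theta>)
      = ext_expectation M (\<lambda>\<omega>. g \<theta> (D0 \<omega>))" for \<theta>
    by (simp add: policy_cost_def g_def D0_def)
  have "\<forall>\<theta>\<in>\<Theta> - S. \<exists>\<theta>'. \<theta>' \<in> \<Theta> \<and>
      ext_expectation M (\<lambda>\<omega>. g \<theta>' (D0 \<omega>)) < ext_expectation M (\<lambda>\<omega>. g \<theta> (D0 \<omega>))"
    by (auto simp: S_def optimal_parameters_def is_arg_min_def cost_eq)
  from bchoice[OF this] obtain better where better: "\<And>\<theta>. \<theta> \<in> \<Theta> - S \<Longrightarrow> better \<theta> \<in> \<Theta>"
    "\<And>\<theta>. \<theta> \<in> \<Theta> - S \<Longrightarrow>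
      ext_expectation M (\<lambda>\<omega>. g (better \<theta>) (D0 \<omega>)) < ext_expectation M (\<lambda>\<omega>. g \<theta> (D0 \<omega>))"
    by blast
  have opt: "\<theta>_opt N \<omega> \<in> \<Theta>"
    "\<And>\<theta>. \<theta> \<in> \<Theta> \<Longrightarrow> (\<Sum>n=1..N. g (\<theta>_opt N \<omega>) (Ds n \<omega>)) \<le> (\<Sum>n=1..N. g \<theta> (Ds n \<omega>))"
    if "1 \<le> N" "\<omega> \<in> space M" for N \<omega>
  proof -
    have emp: "empirical_cost Z f W q \<Psi> (\<lambda>n. Xs n \<omega>) (\<lambda>n. \<xi>s n \<omega>) N
        = (\<lambda>\<theta>. (\<Sum>n=1..N. g \<theta> (Ds n \<omega>)) / real N)"
      by (simp add: fun_eq_iff empirical_cost_def g_def Ds_def forecast_policy_def)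
    have "is_arg_min (\<lambda>\<theta>. (\<Sum>n=1..N. g \<theta> (Ds n \<omega>)) / real N) (\<lambda>\<theta>. \<theta> \<in> \<Theta>) (\<theta>_opt N \<omega>)"
      using \<theta>_opt that unfolding emp[symmetric] by blast
    then show "\<theta>_opt N \<omega> \<in> \<Theta>"
      "\<And>\<theta>. \<theta> \<in> \<Theta> \<Longrightarrow> (\<Sum>n=1..N. g (\<theta>_opt N \<omega>) (Ds n \<omega>)) \<le> (\<Sum>n=1..N. g \<theta> (Ds n \<omega>))"
      using that(1) by (simp_all add: is_arg_min_linorder divide_le_cancel)
  qed
  have "AE \<omega> in M. \<forall>\<theta>\<in>\<Theta> - S. \<forall>\<^sub>F N in sequentially.
      (\<Sum>n=1..N. g (better \<theta>) (Ds n \<omega>)) < (\<Sum>n=1..N. g \<theta> (Ds n \<omega>))"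
  proof (rule AE_finite_allI)
    fix \<theta> assume \<theta>: "\<theta> \<in> \<Theta> - S"
    show "AE \<omega> in M. \<forall>\<^sub>F N in sequentially.
      (\<Sum>n=1..N. g (better \<theta>) (Ds n \<omega>)) < (\<Sum>n=1..N. g \<theta> (Ds n \<omega>))"
    proof (rule AE_eventually_sample_cost_less[OF indep' ident' D0])
      show "integrable M (\<lambda>\<omega>. a - C * norm (\<xi> \<omega>))" using integrable by simp
      show "g \<theta> \<in> borel_measurable borel" "g (better \<theta>) \<in> borel_measurable borel"
        using \<theta> better(1)[OF \<theta>] g_meas by blast+
      show "AE \<omega> in M. a - C * norm (\<xi> \<omega>) \<le> g \<theta> (D0 \<omega>)"
        "AE \<omega> in M. a - C * norm (\<xi> \<omega>) \<le> g (better \<theta>) (D0 \<omega>)"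
        unfolding D0_def by (intro AE_I2 g_lower)+
    qed (simp_all add: better(2)[OF \<theta>])
  qed (use \<Theta> in auto)
  then have consistent: "AE \<omega> in M. \<forall>\<^sub>F N in sequentially. \<theta>_opt N \<omega> \<in> S"
    using AE_space
  proof eventually_elim
    case (elim \<omega>)
    have "\<forall>\<^sub>F N in sequentially. \<forall>\<theta>\<in>\<Theta> - S.
        (\<Sum>n=1..N. g (better \<theta>) (Ds n \<omega>)) < (\<Sum>n=1..N. g \<theta> (Ds n \<omega>))"
      using elim(1) \<Theta>(1) by (intro eventually_ball_finite) auto
    then show ?case
      using eventually_ge_at_top[of 1]
    proof eventually_elim
      case (elim N)
      show ?case
      proof (rule ccontr)
        assume "\<theta>_opt N \<omega> \<notin> S"
        then have bad: "\<theta>_opt N \<omega> \<in> \<Theta> - S" using opt(1) elim(2) \<open>\<omega> \<in> space M\<close> by blast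
        then show False
          using elim(1) opt(2)[OF elim(2) \<open>\<omega> \<in> space M\<close> better(1)[OF bad]] by (meson not_le)
      qed
    qed
  qed
  moreover have "\<exists>K>0. \<exists>\<beta>>0. \<forall>N\<ge>1. prob {\<omega> \<in> space M. \<theta>_opt N \<omega> \<notin> S} \<le> K * exp (- real N * \<beta>)"
    if supp: "bounded (rv_support M \<xi>)" and fZ: "D = UNIV \<or> bdd_above (f ` Z)"
  proof -
    have "bdd_above (f ` Z)"
      using fZ convex_bounded_above_on_bounded[OF _ bounded] convex(2) by auto
    then obtain b where b: "\<And>z. z \<in> Z \<Longrightarrow> f z \<le> b" by (auto simp: bdd_above_def)
    obtain R where R: "\<And>\<zeta>. \<zeta> \<in> rv_support M \<xi> \<Longrightarrow> norm \<zeta> \<le> R"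
      using supp by (auto simp: bounded_iff)
    have g_bounded: "AE \<omega> in M. \<bar>g \<theta> (D0 \<omega>)\<bar> \<le> \<bar>a\<bar> + \<bar>b\<bar> + C * R" for \<theta>
      using AE_in_rv_support[OF borel_measurable_integrable[OF integrable]]
    proof eventually_elim
      case (elim \<omega>)
      have "C * norm (\<xi> \<omega>) \<le> C * R" using R[OF elim] C(1) by (rule mult_left_mono)
      moreover have "\<bar>recourse W q (forecast_policy Z f W q \<Psi> \<theta> (X \<omega>)) (\<xi> \<omega>)\<bar> \<le> C * norm (\<xi> \<omega>)"
        by (rule C(2)[OF policy_in])
      ultimately show ?case
        using a[OF policy_in, of \<theta> "X \<omega>"] b[OF policy_in, of \<theta> "X \<omega>"]
        by (simp add: g_def D0_def total_cost_def)
    qed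
    define E where "E N \<theta> = {\<omega> \<in> space M.
        (\<Sum>n=1..N. g \<theta> (Ds n \<omega>)) \<le> (\<Sum>n=1..N. g (better \<theta>) (Ds n \<omega>))}" for N \<theta>
    have "\<forall>\<theta>\<in>\<Theta> - S. \<exists>\<beta>>0. \<forall>N\<ge>1. prob (E N \<theta>) \<le> exp (- real N * \<beta>)"
    proof
      fix \<theta> assume \<theta>: "\<theta> \<in> \<Theta> - S"
      then have "g \<theta> \<in> borel_measurable borel" "g (better \<theta>) \<in> borel_measurable borel"
        using better(1)[OF \<theta>] g_meas by blast+
      then show "\<exists>\<beta>>0. \<forall>N\<ge>1. prob (E N \<theta>) \<le> exp (- real N * \<beta>)"
        unfolding E_def
        by (intro sample_cost_error_exp_bound
            [OF indep' ident' D0 _ _ g_bounded g_bounded better(2)[OF \<theta>]])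
    qed
    from bchoice[OF this] obtain rate where rate: "\<And>\<theta>. \<theta> \<in> \<Theta> - S \<Longrightarrow> rate \<theta> > 0"
      "\<And>\<theta> N. \<theta> \<in> \<Theta> - S \<Longrightarrow> 1 \<le> N \<Longrightarrow> prob (E N \<theta>) \<le> exp (- real N * rate \<theta>)"
      by blast
    \<comment> \<open>The \<open>1\<close> keeps the minimum defined when every parameter is optimal.\<close>
    define \<beta> where "\<beta> = Min (insert 1 (rate ` (\<Theta> - S)))"
    have "\<beta> > 0" using rate(1) \<Theta>(1) by (auto simp: \<beta>_def)
    have \<beta>_le: "\<beta> \<le> rate \<theta>" if "\<theta> \<in> \<Theta> - S" for \<theta>
      using that \<Theta>(1) by (auto simp: \<beta>_def)
    have "prob {\<omega> \<in> space M. \<theta>_opt N \<omega> \<notin> S} \<le> real (card \<Theta>) * exp (- real N * \<beta>)" if N: "1 \<le> N" for N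
    proof -
      have sum_meas: "(\<lambda>\<omega>. \<Sum>n=1..N. g \<theta> (Ds n \<omega>)) \<in> borel_measurable M" if "\<theta> \<in> \<Theta>" for \<theta>
      proof (rule borel_measurable_sum)
        fix n assume "n \<in> {1..N}"
        then have "Ds n \<in> borel_measurable M"
          using indep' unfolding indep_vars_def by simp
        then show "(\<lambda>\<omega>. g \<theta> (Ds n \<omega>)) \<in> borel_measurable M"
          by (rule measurable_compose) (rule g_meas[OF that])
      qed
      have E_sets: "E N \<theta> \<in> events" if "\<theta> \<in> \<Theta> - S" for \<theta>
        unfolding E_def using that better(1)[OF that] by (intro borel_measurable_le sum_meas) simp_all
      have "{\<omega> \<in> space M. \<theta>_opt N \<omega> \<notin> S} \<subseteq> (\<Union>\<theta>\<in>\<Theta> - S. E N \<theta>)"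
      proof
        fix \<omega> assume "\<omega> \<in> {\<omega> \<in> space M. \<theta>_opt N \<omega> \<notin> S}"
        then have \<omega>: "\<omega> \<in> space M" and bad: "\<theta>_opt N \<omega> \<in> \<Theta> - S"
          using opt(1)[OF N] by auto
        have "\<omega> \<in> E N (\<theta>_opt N \<omega>)"
          using \<omega> opt(2)[OF N \<omega> better(1)[OF bad]] by (simp add: E_def)
        then show "\<omega> \<in> (\<Union>\<theta>\<in>\<Theta> - S. E N \<theta>)" using bad by blast
      qed
      then have "prob {\<omega> \<in> space M. \<theta>_opt N \<omega> \<notin> S} \<le> prob (\<Union>\<theta>\<in>\<Theta> - S. E N \<theta>)"
        using \<Theta>(1) E_sets by (intro finite_measure_mono) auto
      also have "\<dots> \<le> (\<Sum>\<theta>\<in>\<Theta> - S. prob (E N \<theta>))"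
        using \<Theta>(1) E_sets by (intro finite_measure_subadditive_finite) auto
      also have "\<dots> \<le> (\<Sum>\<theta>\<in>\<Theta> - S. exp (- real N * \<beta>))"
        using \<beta>_le
        by (intro sum_mono order_trans[OF rate(2)[OF _ N]]) (auto intro!: mult_left_mono)
      also have "\<dots> \<le> real (card \<Theta>) * exp (- real N * \<beta>)"
        using \<Theta>(1) by (auto intro: card_mono)
      finally show ?thesis .
    qed
    moreover have "0 < real (card \<Theta>)" using \<Theta> by (simp add: card_gt_0_iff)
    ultimately show ?thesis using \<open>\<beta> > 0\<close> by blast
  qed
  ultimately show ?thesis by (simp add: S_def)
qed

end
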